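(* There are Puiseux monoids satisfying the ACCP that are not BFMs.
   Context: A Puiseux monoid is an additive submonoid $M$ of $\mathbb{Q}_{\ge 0}$. A principal ideal of $M$ is a subset of the form $x + M$ with $x \in M$; $M$ satisfies the ACCP if every increasing (under inclusion) sequence of principal ideals of $M$ eventually stabilizes. An element $a \in M \setminus\{0\}$ is an atom if $a = x+y$ with $x,y \in M$ implies $x=0$ or $y=0$; $M$ is atomic if each nonzero element is a (finite) sum of atoms. A factorization of $x \in M$ is a finite multiset of atoms of $M$ with sum $x$; its length is the number of atoms counted with multiplicity; $\mathsf{L}(x)$ is the set of lengths of all factorizations of $x$. $M$ is a BFM (bounded factorization monoid) if $M$ is atomic and $|\mathsf{L}(x)| < \infty$ for all $x \in M$. *)

theory Defs
  imports Complex_Main "HOL-Library.Multiset"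
begin

definition puiseux_monoid :: "rat set \<Rightarrow> bool" where
  "puiseux_monoid M \<longleftrightarrow>
     M \<subseteq> {q. 0 \<le> q} \<and> 0 \<in> M \<and> (\<forall>x\<in>M. \<forall>y\<in>M. x + y \<in> M)"

definition principal_ideal :: "rat set \<Rightarrow> rat set \<Rightarrow> bool" where
  "principal_ideal M I \<longleftrightarrow> (\<exists>x\<in>M. I = (\<lambda>m. x + m) ` M)"

definition ACCP :: "rat set \<Rightarrow> bool" where
  "ACCP M \<longleftrightarrow>
     (\<forall>I :: nat \<Rightarrow> rat set.
        (\<forall>n. principal_ideal M (I n)) \<and> (\<forall>n. I n \<subseteq> I (Suc n)) \<longrightarrow>
        (\<exists>N. \<forall>n\<ge>N. I n = I N))"

definition atoms :: "rat set \<Rightarrow> rat set" where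
  "atoms M = {a \<in> M - {0}. \<forall>x\<in>M. \<forall>y\<in>M. a = x + y \<longrightarrow> x = 0 \<or> y = 0}"

text \<open>The empty multiset is the only factorization of \<open>0\<close>.\<close>

definition factorizations :: "rat set \<Rightarrow> rat \<Rightarrow> rat multiset set" where
  "factorizations M x = {F. set_mset F \<subseteq> atoms M \<and> sum_mset F = x}"

definition lengths :: "rat set \<Rightarrow> rat \<Rightarrow> nat set" where
  "lengths M x = size ` factorizations M x"

definition atomic :: "rat set \<Rightarrow> bool" where
  "atomic M \<longleftrightarrow> (\<forall>x \<in> M - {0}. factorizations M x \<noteq> {})"

definition BFM :: "rat set \<Rightarrow> bool" where
  "BFM M \<longleftrightarrow> atomic M \<and> (\<forall>x\<in>M. finite (lengths M x))"

end

theory Submission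
  imports Defs "HOL-Computational_Algebra.Primes"
begin

text \<open>
  The witness is the monoid \<open>M\<close> generated by the reciprocals of the primes. If it is atomic, then
  writing \<open>1 = p \<sdot> (1/p)\<close> and factoring \<open>1/p\<close> gives factorizations of \<open>1\<close> of length at least \<open>p\<close>
  for every prime \<open>p\<close>, so \<open>M\<close> is not a BFM.
  If \<open>y \<in> M\<close> but \<open>y - 1 \<notin> M\<close>, then a sum of reciprocals of primes representing \<open>y\<close> uses each \<open>1/p\<close>
  fewer than \<open>p\<close> times, and only for primes \<open>p\<close> dividing the denominator of \<open>y\<close>; hence the number
  of summands is bounded. For a chain of principal ideals generated by \<open>x\<^sub>0, x\<^sub>1, \<dots>\<close>, subtract the
  largest integer \<open>k\<close> such that all \<open>x\<^sub>n - k\<close> lie in \<open>M\<close>. Some \<open>x\<^sub>n - k\<close> is then of this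
  bounded kind, so only finitely many of the later differences can be nonzero.
\<close>

text \<open>Elements of the monoid are handled through multisets of denominators:
  \<open>count\<close> then gives the number of copies of \<open>1/p\<close>, and
  \<open>size\<close> the number of summands to be bounded.\<close>

definition reciprocal_sum :: "nat multiset \<Rightarrow> rat" where
  "reciprocal_sum F = (\<Sum>p\<in>#F. 1 / of_nat p)"

definition prime_reciprocal_monoid :: "rat set" where
  "prime_reciprocal_monoid = {reciprocal_sum F | F. \<forall>p\<in>#F. prime p}"

lemma reciprocal_sum_empty [simp]: "reciprocal_sum {#} = 0"
  by (simp add: reciprocal_sum_def)

lemma reciprocal_sum_add_mset [simp]:
  "reciprocal_sum (add_mset p F) = 1 / of_nat p + reciprocal_sum F"
  by (simp add: reciprocal_sum_def)

lemma reciprocal_sum_union [simp]: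
  "reciprocal_sum (F + G) = reciprocal_sum F + reciprocal_sum G"
  by (simp add: reciprocal_sum_def)

lemma reciprocal_sum_replicate_mset [simp]:
  "reciprocal_sum (replicate_mset n p) = of_nat n / of_nat p"
  by (induction n) (simp_all add: add_divide_distrib)

lemma reciprocal_sum_sum:
  "reciprocal_sum (\<Sum>i\<in>A. G i) = (\<Sum>i\<in>A. reciprocal_sum (G i))"
  by (induction A rule: infinite_finite_induct) simp_all

lemma reciprocal_sum_nonneg: "reciprocal_sum F \<ge> 0"
  by (induction F) simp_all

text \<open>The product of the entries is a common denominator. It serves to clear the denominators
  of all summands other than copies of a fixed \<open>1/p\<close>.\<close>

lemma reciprocal_sum_times_prod_mset:
  assumes "0 \<notin># F"
  shows "\<exists>a. reciprocal_sum F * of_nat (prod_mset F) = of_nat a"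
  using assms
proof (induction F)
  case (add p F)
  then obtain a where a: "reciprocal_sum F * of_nat (prod_mset F) = of_nat a" by auto
  have "p \<noteq> 0" using add.prems by auto
  then have "reciprocal_sum (add_mset p F) * of_nat (prod_mset (add_mset p F))
      = of_nat (prod_mset F) + of_nat p * (reciprocal_sum F * of_nat (prod_mset F))"
    by (simp add: algebra_simps)
  then show ?case using a by (metis of_nat_add of_nat_mult)
qed simp

text \<open>With \<open>c\<close> copies of \<open>1/p\<close>, the sum is \<open>c/p\<close> plus a
  fraction whose denominator is coprime to \<open>p\<close>. Since \<open>0 < c < p\<close>, the
  \<open>p\<close> cannot cancel, so it divides every denominator of the sum, in lowest terms or
  not.\<close>

lemma prime_dvd_denominator:
  assumes "\<forall>q\<in>#F. prime q" and "p \<in># F" and "count F p < p"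
    and y: "reciprocal_sum F = of_int u / of_int v" and "v \<noteq> 0"
  shows "int p dvd v"
proof -
  define c where "c = count F p"
  define G where "G = filter_mset (\<lambda>q. q \<noteq> p) F"
  have F: "F = replicate_mset c p + G"
    unfolding c_def G_def by (rule multiset_eqI) auto
  have p: "prime p" using assms by auto
  have G: "\<forall>q\<in>#G. prime q" and "p \<notin># G" using assms(1) by (auto simp: G_def)
  have "0 \<notin># G" using G by auto
  then obtain a where a: "reciprocal_sum G * of_nat (prod_mset G) = of_nat a"
    using reciprocal_sum_times_prod_mset by blast
  have "\<not> p dvd prod_mset G"
    using G p \<open>p \<notin># G\<close> by (metis prime_dvd_prod_mset_iff primes_dvd_imp_eq)
  moreover have "\<not> p dvd c"
    using assms(2,3) by (auto simp: c_def dest: dvd_imp_le)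
  \<comment> \<open>Multiplying the equation by \<open>p\<close>, \<open>v\<close> and
    \<open>prod_mset G\<close> leaves a multiple of \<open>p\<close> in every term except the one
    coming from \<open>c/p\<close>.\<close>
  moreover have "int p dvd int c * int (prod_mset G) * v"
  proof -
    have "of_int u / of_int v = of_nat c / of_nat p + reciprocal_sum G"
      using y F by simp
    then have "of_int u * of_nat p = of_nat c * of_int v + reciprocal_sum G * of_nat p * of_int v"
      using p \<open>v \<noteq> 0\<close> by (auto simp: field_simps)
    then have "of_int u * of_nat p * of_nat (prod_mset G)
        = of_nat c * of_int v * of_nat (prod_mset G)
          + (reciprocal_sum G * of_nat (prod_mset G)) * of_nat p * of_int v"
      by (simp add: algebra_simps)
    then have "(of_int (u * int p * int (prod_mset G)) :: rat)
        = of_int (int c * v * int (prod_mset G) + int a * int p * v)"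
      using a by simp
    then have "u * int p * int (prod_mset G) = int c * v * int (prod_mset G) + int a * int p * v"
      using of_int_eq_iff by blast
    then have "int c * int (prod_mset G) * v = int p * (u * int (prod_mset G) - int a * v)"
      by (simp add: algebra_simps)
    then show ?thesis by simp
  qed
  ultimately show ?thesis
    using p by (auto simp: prime_dvd_mult_iff)
qed

lemma reciprocal_sum_in_monoid:
  "\<forall>p\<in>#F. prime p \<Longrightarrow> reciprocal_sum F \<in> prime_reciprocal_monoid"
  unfolding prime_reciprocal_monoid_def by blast

lemma in_monoidE:
  assumes "x \<in> prime_reciprocal_monoid"
  obtains F where "\<forall>p\<in>#F. prime p" "x = reciprocal_sum F"
  using assms unfolding prime_reciprocal_monoid_def by blast

lemma puiseux_prime_reciprocal_monoid: "puiseux_monoid prime_reciprocal_monoid"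
  unfolding puiseux_monoid_def
proof (intro conjI ballI)
  show "prime_reciprocal_monoid \<subseteq> {q. 0 \<le> q}"
    by (auto elim!: in_monoidE simp: reciprocal_sum_nonneg)
  show "0 \<in> prime_reciprocal_monoid"
    using reciprocal_sum_in_monoid[of "{#}"] by simp
  fix x y assume "x \<in> prime_reciprocal_monoid" "y \<in> prime_reciprocal_monoid"
  then obtain F G where "\<forall>p\<in>#F. prime p" "x = reciprocal_sum F"
      "\<forall>p\<in>#G. prime p" "y = reciprocal_sum G"
    by (metis in_monoidE)
  then show "x + y \<in> prime_reciprocal_monoid"
    using reciprocal_sum_in_monoid[of "F + G"] by auto
qed

lemma size_representation_bounded:
  assumes "y - 1 \<notin> prime_reciprocal_monoid"
  shows "\<exists>B. \<forall>F. (\<forall>p\<in>#F. prime p) \<longrightarrow> reciprocal_sum F = y \<longrightarrow> size F \<le> B"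
proof -
  obtain u v where y: "y = of_int u / of_int v" and v: "v > 0"
    by (metis quotient_of_denom_pos quotient_of_div surj_pair)
  \<comment> \<open>Only primes up to \<open>v\<close> can occur, each fewer than \<open>p\<close>
    times, so the sum of all naturals up to \<open>v\<close> is a crude bound that does not depend
    on \<open>F\<close>.\<close>
  have "size F \<le> \<Sum>{..nat v}" if F: "\<forall>p\<in>#F. prime p" "reciprocal_sum F = y" for F
  proof -
    \<comment> \<open>Since \<open>p\<close> copies of \<open>1/p\<close> add up to
      \<open>1\<close>, removing them would leave a representation of \<open>y - 1\<close>.\<close>
    have less: "count F p < p" if "p \<in># F" for p
    proof (rule ccontr)
      assume "\<not> count F p < p"
      then have "replicate_mset p p \<subseteq># F" by (simp flip: count_le_replicate_mset_subset_eq)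
      then obtain G where G: "F = replicate_mset p p + G" by (auto simp: subset_mset.le_iff_add)
      moreover have "p \<noteq> 0" using that F by (metis not_prime_0)
      ultimately have "y - 1 = reciprocal_sum G" using F by auto
      then show False using assms F G reciprocal_sum_in_monoid[of G] by auto
    qed
    have "p \<le> nat v" if "p \<in># F" for p
    proof -
      have "int p dvd v"
        using prime_dvd_denominator[of F p u v] F that less y v by auto
      then show ?thesis using v zdvd_imp_le by fastforce
    qed
    then have sub: "set_mset F \<subseteq> {..nat v}" by auto
    have "size F = (\<Sum>p\<in>set_mset F. count F p)" by (simp add: size_multiset_overloaded_eq)
    also have "\<dots> \<le> \<Sum>(set_mset F)" using less by (intro sum_mono) (simp add: less_imp_le)
    also have "\<dots> \<le> \<Sum>{..nat v}" using sub by (intro sum_mono2) auto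
    finally show ?thesis .
  qed
  then show ?thesis by blast
qed

lemma ACCP_prime_reciprocal_monoid: "ACCP prime_reciprocal_monoid"
  unfolding ACCP_def
proof (intro allI impI, elim conjE)
  let ?M = prime_reciprocal_monoid
  fix I :: "nat \<Rightarrow> rat set"
  assume "\<forall>n. principal_ideal ?M (I n)" and mono: "\<forall>n. I n \<subseteq> I (Suc n)"
  then obtain x where x: "\<And>n. x n \<in> ?M" and I: "\<And>n. I n = (\<lambda>m. x n + m) ` ?M"
    unfolding principal_ideal_def by metis
  have zero: "0 \<in> ?M" and nonneg: "\<And>z. z \<in> ?M \<Longrightarrow> z \<ge> 0"
    using puiseux_prime_reciprocal_monoid by (auto simp: puiseux_monoid_def)
  have "\<exists>G. (\<forall>p\<in>#G. prime p) \<and> x n = x (Suc n) + reciprocal_sum G" for n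
  proof -
    have "x n \<in> I n" using zero by (force simp: I)
    then have "x n \<in> I (Suc n)" using mono by blast
    then show ?thesis by (auto simp: I elim!: in_monoidE)
  qed
  then obtain G where G: "\<And>n. \<forall>p\<in>#G n. prime p"
    and x_eq: "\<And>n. x n = x (Suc n) + reciprocal_sum (G n)"
    by metis
  \<comment> \<open>\<open>K\<close> consists of the naturals that can be subtracted from the whole
    chain at once; \<open>x 0\<close> bounds it, so it has a maximum.\<close>
  define K where "K = {k::nat. \<forall>n. x n - of_nat k \<in> ?M}"
  have "K \<subseteq> {..nat \<lfloor>x 0\<rfloor>}"
  proof
    fix k assume "k \<in> K"
    then have "of_nat k \<le> x 0" using nonneg[of "x 0 - of_nat k"] by (auto simp: K_def)
    then show "k \<in> {..nat \<lfloor>x 0\<rfloor>}" using le_floor_iff[of "int k" "x 0"] by simp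
  qed
  then have fin: "finite K" using finite_subset by blast
  have "0 \<in> K" using x by (simp add: K_def)
  define k where "k = Max K"
  have "k \<in> K" using fin \<open>0 \<in> K\<close> by (auto simp: k_def intro: Max_in)
  have "Suc k \<notin> K" using Max_ge[OF fin, of "Suc k"] Suc_n_not_le_n[of k] unfolding k_def by blast
  \<comment> \<open>Maximality of \<open>k\<close> fails \<open>k + 1\<close> at some index
    \<open>n0\<close>, which is the hypothesis of the size bound for
    \<open>y = x n0 - k\<close>.\<close>
  then obtain n0 where n0: "x n0 - of_nat k - 1 \<notin> ?M" by (auto simp: K_def algebra_simps)
  obtain B where B: "\<And>F. \<forall>p\<in>#F. prime p \<Longrightarrow> reciprocal_sum F = x n0 - of_nat k \<Longrightarrow> size F \<le> B"
    using size_representation_bounded[OF n0] by blast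
  have telescope: "x n0 = x (n0 + d) + (\<Sum>i\<in>{n0..<n0+d}. reciprocal_sum (G i))" for d
  proof (induction d)
    case (Suc d)
    then show ?case using x_eq[of "n0 + d"] by simp
  qed simp
  \<comment> \<open>Because \<open>k\<close> works at every index, \<open>x (n0 + d) - k\<close> has
    a representation \<open>H\<close>. Adding the intermediate differences to \<open>H\<close>
    represents \<open>x n0 - k\<close>, so \<open>B\<close> bounds their total size for all
    \<open>d\<close> simultaneously.\<close>
  have bound: "(\<Sum>i\<in>{n0..<n0+d}. size (G i)) \<le> B" for d
  proof -
    have "x (n0 + d) - of_nat k \<in> ?M" using \<open>k \<in> K\<close> by (simp add: K_def)
    then obtain H where H: "\<forall>p\<in>#H. prime p" "x (n0 + d) - of_nat k = reciprocal_sum H"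
      by (rule in_monoidE)
    have "size (H + (\<Sum>i\<in>{n0..<n0+d}. G i)) \<le> B"
    proof (rule B)
      show "\<forall>p\<in>#H + (\<Sum>i\<in>{n0..<n0+d}. G i). prime p"
        using H G by (auto simp: set_mset_sum)
      show "reciprocal_sum (H + (\<Sum>i\<in>{n0..<n0+d}. G i)) = x n0 - of_nat k"
        using H telescope[of d] by (simp add: reciprocal_sum_sum)
    qed
    then show ?thesis by (simp add: size_multiset_sum)
  qed
  \<comment> \<open>Each nonempty \<open>G i\<close> contributes at least one to the bounded total,
    so at most \<open>B\<close> of them occur from \<open>n0\<close> on.\<close>
  have "finite {i. n0 \<le> i \<and> G i \<noteq> {#}}"
  proof (rule ccontr)
    assume "infinite {i. n0 \<le> i \<and> G i \<noteq> {#}}"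
    then obtain T where T: "T \<subseteq> {i. n0 \<le> i \<and> G i \<noteq> {#}}" "finite T" "card T = Suc B"
      using infinite_arbitrarily_large by blast
    define d where "d = Suc (Max T)"
    have sub: "T \<subseteq> {n0..<n0+d}"
      using T(1) Max_ge[OF T(2)] by (force simp: d_def less_Suc_eq_le intro: trans_le_add2)
    have "card T = (\<Sum>i\<in>T. 1)" by simp
    also have "\<dots> \<le> (\<Sum>i\<in>T. size (G i))"
      using T(1) by (intro sum_mono) (auto simp: Suc_le_eq nonempty_has_size)
    also have "\<dots> \<le> (\<Sum>i\<in>{n0..<n0+d}. size (G i))"
      using sub by (intro sum_mono2) auto
    finally show False using bound[of d] T(3) by simp
  qed
  then obtain N where N: "\<And>i. n0 \<le> i \<Longrightarrow> G i \<noteq> {#} \<Longrightarrow> i < N"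
    by (auto simp: finite_nat_set_iff_bounded)
  have "I n = I (max n0 N)" if "n \<ge> max n0 N" for n
    using that
  proof (induction n rule: dec_induct)
    case (step n)
    then have "G n = {#}" using N[of n] by force
    then have "x n = x (Suc n)" using x_eq[of n] by simp
    then show ?case using step.IH by (simp add: I)
  qed simp
  then show "\<exists>N. \<forall>n\<ge>N. I n = I N" by blast
qed

lemma not_BFM_prime_reciprocal_monoid: "\<not> BFM prime_reciprocal_monoid"
proof
  let ?M = prime_reciprocal_monoid
  assume bfm: "BFM ?M"
  have one: "reciprocal_sum (replicate_mset 2 2) = 1" by simp
  have "1 \<in> ?M" using reciprocal_sum_in_monoid[of "replicate_mset 2 2"] unfolding one by auto
  then have "finite (lengths ?M 1)" using bfm by (simp add: BFM_def)
  then obtain B where B: "\<And>l. l \<in> lengths ?M 1 \<Longrightarrow> l \<le> B"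
    by (auto simp: finite_nat_set_iff_bounded_le)
  obtain p :: nat where p: "prime p" "p > B" using bigger_prime by blast
  then have "p \<noteq> 0" by auto
  have "1 / of_nat p \<in> ?M - {0}"
    using reciprocal_sum_in_monoid[of "{#p#}"] p by auto
  then have "factorizations ?M (1 / of_nat p) \<noteq> {}"
    using bfm by (simp add: BFM_def atomic_def)
  then obtain F where F: "set_mset F \<subseteq> atoms ?M" "sum_mset F = 1 / of_nat p"
    by (auto simp: factorizations_def)
  have "F \<noteq> {#}" using F(2) \<open>p \<noteq> 0\<close> by auto
  have "sum_mset (repeat_mset n F) = of_nat n * sum_mset F" for n
    by (induction n) (simp_all add: algebra_simps)
  \<comment> \<open>Repeating the nonempty \<open>F\<close> \<open>p\<close> times factors
    \<open>1\<close> into at least \<open>p > B\<close> atoms.\<close>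
  then have "sum_mset (repeat_mset p F) = 1" using F \<open>p \<noteq> 0\<close> by simp
  moreover have "set_mset (repeat_mset n F) \<subseteq> set_mset F" for n
    by (induction n) auto
  ultimately have "repeat_mset p F \<in> factorizations ?M 1"
    using F(1) unfolding factorizations_def by blast
  then have "p * size F \<le> B" using B by (force simp: lengths_def)
  moreover have "p \<le> p * size F" using \<open>F \<noteq> {#}\<close> by (simp add: Suc_le_eq nonempty_has_size)
  ultimately show False using p by simp
qed

theorem corollary4p6:
  shows "\<exists>M :: rat set. puiseux_monoid M \<and> ACCP M \<and> \<not> BFM M"
  using puiseux_prime_reciprocal_monoid ACCP_prime_reciprocal_monoid
    not_BFM_prime_reciprocal_monoid by blast

end
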